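(* Let $n\ge 1$ be an integer and let $a>0$ be a real number. Among all node vectors $(t_0,\ldots,t_n)$ with $0\le t_0<t_1<\cdots<t_n\le a$, the optimal nodes for the function extension formula $E_n[f](x)=\sum_{j=0}^n w_j f(-t_j x)$, $x\in[-1,0]$ (that is, the nodes minimizing $\|w\|_1=\sum_{i=0}^n|w_i|$, where the weights $w$ are determined by the nodes through the Vandermonde system $\sum_{j=0}^n w_j t_j^i=(-1)^i$, $i=0,\ldots,n$) are the Chebyshev nodes of the second kind shifted and scaled to the interval $[0,a]$: $$t_i^\ast=\frac a2\left(1-\cos\left(\frac{i\pi}{n}\right)\right),\qquad i=0,\ldots,n.$$ The associated optimal weights are $$w_i^\ast=(-1)^i\frac{C_n(a)}{(1+\delta_{i0}+\delta_{in})\,n\,a\,(1+t_i^\ast)},\qquad i=0,\ldots,n,$$ where $$C_n(a)=\frac{1+a}{\sqrt{x_0^2-1}}\left(\left(x_0+\sqrt{x_0^2-1}\right)^n-\left(x_0-\sqrt{x_0^2-1}\right)^n\right),\qquad x_0=1+\frac 2a.$$ Finally, the $\ell^1$ norm of the associated optimal weights is $$\|w^\ast\|_1=\sum_{i=0}^n|w_i^\ast|=T_n\left(1+\frac 2a\right)=\frac12\left(\left(1+\frac2a-2\sqrt{\frac1a+\frac1{a^2}}\right)^n+\left(1+\frac2a+2\sqrt{\frac1a+\frac1{a^2}}\right)^n\right).$$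
   Context: Functions $f\in\mathcal{C}^n([0,a])$ are extended to $[-1,0]$ by $E_n[f](x)=\sum_{j=0}^n w_j f(-t_jx)$, with nodes $0\le t_0<t_1<\cdots<t_n\le a$ and real weights $w_0,\ldots,w_n$. Matching the values and derivatives up to order $n$ at $x=0$ gives the Vandermonde system $\sum_{j=0}^n w_jt_j^i=(-1)^i$ for $i=0,\ldots,n$ (with $t_j^0=1$), which determines $w$ uniquely from the distinct nodes. The nodes are called optimal if they minimize $\|w\|_1=\sum_{i=0}^n|w_i|$ over all such node choices in $[0,a]$; the associated weights are the optimal weights. $T_n$ is the Chebyshev polynomial of the first kind of degree $n$, and $\delta_{ij}$ is the Kronecker delta. *)

theory Defs
  imports "HOL-Analysis.Analysis" "HOL-Computational_Algebra.Polynomial"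
begin

text \<open>
  A node vector \<open>(t\<^sub>0, \<dots>, t\<^sub>n)\<close> and a weight vector \<open>(w\<^sub>0, \<dots>, w\<^sub>n)\<close> are functions on \<^typ>\<open>nat\<close>
  of which only the values at indices \<open>\<le> n\<close> matter.
\<close>

definition admissible_nodes :: "nat \<Rightarrow> real \<Rightarrow> (nat \<Rightarrow> real) \<Rightarrow> bool" where
  "admissible_nodes n a t \<longleftrightarrow> 0 \<le> t 0 \<and> (\<forall>i<n. t i < t (Suc i)) \<and> t n \<le> a"

text \<open>
  The extension \<open>E\<^sub>n[f](x) = (\<Sum>j\<le>n. w\<^sub>j f(-t\<^sub>j x))\<close> agrees with \<open>f\<close> at \<open>x = 0\<close> up to the
  \<open>n\<close>-th derivative, for every \<open>f\<close> of class \<open>C\<^sup>n\<close>, iff the following Vandermonde system holds.  Here \<open>0 ^ 0 = 1\<close>, so that the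
  equation for \<open>i = 0\<close> is \<open>(\<Sum>j\<le>n. w\<^sub>j) = 1\<close> also when \<open>t\<^sub>0 = 0\<close>.
\<close>

definition vandermonde_system :: "nat \<Rightarrow> (nat \<Rightarrow> real) \<Rightarrow> (nat \<Rightarrow> real) \<Rightarrow> bool" where
  "vandermonde_system n t w \<longleftrightarrow> (\<forall>i\<le>n. (\<Sum>j\<le>n. w j * t j ^ i) = (-1) ^ i)"

text \<open>
  The weights are set to \<open>0\<close> beyond index \<open>n\<close> only to make the function unique; that it is
  well-defined for distinct nodes is \<open>vandermonde_system_ex1\<close> below.
\<close>

definition extension_weights :: "nat \<Rightarrow> (nat \<Rightarrow> real) \<Rightarrow> nat \<Rightarrow> real" where
  "extension_weights n t = (THE w. vandermonde_system n t w \<and> (\<forall>j>n. w j = 0))"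

definition l1_norm :: "nat \<Rightarrow> (nat \<Rightarrow> real) \<Rightarrow> real" where
  "l1_norm n w = (\<Sum>i\<le>n. \<bar>w i\<bar>)"

definition optimal_nodes :: "nat \<Rightarrow> real \<Rightarrow> (nat \<Rightarrow> real) \<Rightarrow> bool" where
  "optimal_nodes n a t \<longleftrightarrow>
     is_arg_min (\<lambda>s. l1_norm n (extension_weights n s)) (admissible_nodes n a) t"

definition chebyshev_nodes :: "nat \<Rightarrow> real \<Rightarrow> nat \<Rightarrow> real" where
  "chebyshev_nodes n a i = a / 2 * (1 - cos (real i * pi / real n))"

fun chebyshev_T :: "nat \<Rightarrow> real poly" where
  "chebyshev_T 0 = 1"
| "chebyshev_T (Suc 0) = [:0, 1:]"
| "chebyshev_T (Suc (Suc n)) = [:0, 2:] * chebyshev_T (Suc n) - chebyshev_T n"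

definition kronecker :: "nat \<Rightarrow> nat \<Rightarrow> real" where
  "kronecker i j = (if i = j then 1 else 0)"

definition C_const :: "nat \<Rightarrow> real \<Rightarrow> real" where
  "C_const n a = (let x0 = 1 + 2 / a; r = sqrt (x0\<^sup>2 - 1)
     in (1 + a) / r * ((x0 + r) ^ n - (x0 - r) ^ n))"

lemma vandermonde_system_poly:
  assumes "vandermonde_system n t w" and "degree p \<le> n"
  shows "(\<Sum>j\<le>n. w j * poly p (t j)) = poly p (-1)"
proof -
  have *: "poly p x = (\<Sum>i\<le>n. coeff p i * x ^ i)" for x
    unfolding poly_altdef using assms(2)
    by (intro sum.mono_neutral_left) (auto simp: coeff_eq_0)
  have "(\<Sum>j\<le>n. w j * poly p (t j)) = (\<Sum>j\<le>n. \<Sum>i\<le>n. coeff p i * (w j * t j ^ i))"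
    by (simp add: * sum_distrib_left algebra_simps)
  also have "\<dots> = (\<Sum>i\<le>n. \<Sum>j\<le>n. coeff p i * (w j * t j ^ i))"
    by (rule sum.swap)
  also have "\<dots> = (\<Sum>i\<le>n. coeff p i * (-1) ^ i)"
    using assms(1) by (simp add: vandermonde_system_def flip: sum_distrib_left)
  finally show ?thesis by (simp add: *)
qed

lemma vandermonde_system_ex1:
  assumes inj: "inj_on t {..n}"
  shows "\<exists>!w. vandermonde_system n t w \<and> (\<forall>j>n. w j = 0)"
proof -
  define L where "L j = (\<Prod>k\<in>{..n} - {j}. smult (1 / (t j - t k)) [:- t k, 1:])" for j
  have deg: "degree (L j) \<le> n" if "j \<le> n" for j
  proof -
    have "degree (L j) \<le> (\<Sum>k\<in>{..n} - {j}. degree (smult (1 / (t j - t k)) [:- t k, 1:]))"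
      unfolding L_def by (rule order.trans[OF degree_prod_sum_le]) (simp_all only: o_def finite_Diff finite_atMost order.refl)
    also have "\<dots> \<le> (\<Sum>k\<in>{..n} - {j}. 1)"
      by (intro sum_mono order.trans[OF degree_smult_le]) simp
    also have "\<dots> = n" using that by simp
    finally show ?thesis .
  qed
  have L_eval: "poly (L j) (t k) = (if j = k then 1 else 0)" if "j \<le> n" "k \<le> n" for j k
  proof (cases "j = k")
    case True
    have "t k - t m \<noteq> 0" if "m \<in> {..n} - {k}" for m
      using inj that \<open>k \<le> n\<close> by (auto dest: inj_onD)
    hence "poly (smult (1 / (t k - t m)) [:- t m, 1:]) (t k) = 1" if "m \<in> {..n} - {k}" for m
      using that by (simp flip: diff_divide_distrib)
    thus ?thesis using True by (simp add: L_def poly_prod del: poly_smult)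
  next
    case False
    thus ?thesis using that by (auto simp: L_def poly_prod)
  qed
  show ?thesis
  proof (rule ex1I[of _ "\<lambda>j. if j \<le> n then poly (L j) (-1) else 0"], intro conjI allI impI)
    show "vandermonde_system n t (\<lambda>j. if j \<le> n then poly (L j) (-1) else 0)"
      unfolding vandermonde_system_def
    proof (intro allI impI)
      fix i assume i: "i \<le> n"
      define p where "p = (\<Sum>j\<le>n. smult (t j ^ i) (L j)) - monom 1 i"
      have "p = 0"
      proof (rule ccontr)
        assume "p \<noteq> 0"
        have "degree p \<le> n"
          unfolding p_def using deg i
          by (intro degree_diff_le degree_sum_le) (auto simp: degree_monom_eq intro: order.trans[OF degree_smult_le])
        moreover have "t ` {..n} \<subseteq> {x. poly p x = 0}"
          by (auto simp: p_def poly_sum poly_monom L_eval if_distrib cong: if_cong)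
        hence "card (t ` {..n}) \<le> card {x. poly p x = 0}"
          using \<open>p \<noteq> 0\<close> by (intro card_mono poly_roots_finite)
        hence "Suc n \<le> card {x. poly p x = 0}"
          using inj by (simp add: card_image)
        moreover have "card {x. poly p x = 0} \<le> degree p"
          using \<open>p \<noteq> 0\<close> by (rule card_poly_roots_bound)
        ultimately show False by simp
      qed
      hence "poly p (-1) = 0" by simp
      thus "(\<Sum>j\<le>n. (if j \<le> n then poly (L j) (-1) else 0) * t j ^ i) = (-1) ^ i"
        by (simp add: p_def poly_sum poly_monom mult.commute)
    qed
  next
    fix w assume w: "vandermonde_system n t w \<and> (\<forall>j>n. w j = 0)"
    show "w = (\<lambda>j. if j \<le> n then poly (L j) (-1) else 0)"
    proof
      fix j
      show "w j = (if j \<le> n then poly (L j) (-1) else 0)"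
      proof (cases "j \<le> n")
        case True
        have "poly (L j) (-1) = (\<Sum>k\<le>n. w k * poly (L j) (t k))"
          using vandermonde_system_poly[of n t w "L j"] w deg[OF True] by simp
        also have "\<dots> = w j"
          using True by (simp add: L_eval if_distrib cong: if_cong)
        finally show ?thesis using True by simp
      qed (use w in auto)
    qed
  qed auto
qed

end

theory Submission
  imports Defs
begin

text \<open>
  The Vandermonde system says that \<open>\<Sum>\<^sub>j w\<^sub>j p(t\<^sub>j) = p(-1)\<close> for every polynomial \<open>p\<close> of degree at most
  \<open>n\<close>, so the weights extrapolate polynomials from the nodes in \<open>[0, a]\<close> to the point \<open>-1\<close>.  The
  optimality proof tests this on a single polynomial, the shifted Chebyshev polynomial
  \<open>q(x) = T\<^sub>n(1 - 2 x / a)\<close>.  It is bounded by \<open>1\<close> on \<open>[0, a]\<close>, hence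
  \<open>T\<^sub>n(1 + 2 / a) = q(-1) = \<Sum>\<^sub>j w\<^sub>j q(t\<^sub>j) \<le> \<parallel>w\<parallel>\<^sub>1\<close> for all nodes.  No weight can vanish, because \<open>-1\<close>
  is not a node; equality therefore forces \<open>\<bar>q(t\<^sub>j)\<bar> = 1\<close> for all \<open>j\<close>.  The polynomial \<open>q\<close> attains \<open>\<plusminus>1\<close>
  in \<open>[0, a]\<close> only at the \<open>n + 1\<close> points \<open>t\<^sub>i\<^sup>*\<close>, so \<open>n + 1\<close> increasing nodes
  with this property are exactly these points (\<open>l1_norm_weights_ge\<close>, \<open>nodes_eq_if_l1_norm_le\<close>).

  Conversely \<open>q(t\<^sub>i\<^sup>*) = (-1)\<^sup>i\<close>, so the bound is attained at \<open>t\<^sup>*\<close> once the weight \<open>w\<^sub>i\<^sup>*\<close> is known to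
  have the sign \<open>(-1)\<^sup>i\<close>.  This can be read off the explicit weights.  These come
  from testing the system on the polynomial that vanishes at all nodes but one: the \<open>t\<^sub>i\<^sup>*\<close> are, up to
  the affine substitution, the zeros of \<open>(1 - y\<^sup>2) U\<^bsub>n-1\<^esub>(y)\<close>, and dividing this by the linear
  factor of one zero leaves a polynomial whose values at \<open>1 + 2 / a\<close> and at that zero have the
  quotient \<open>w\<^sub>i\<^sup>*\<close> (\<open>chebyshev_weight_eq\<close>).  The closed forms in \<open>x\<^sub>0\<close> are the identity
  \<open>(x + r)\<^sup>n = T\<^sub>n(x) + r U\<^bsub>n-1\<^esub>(x)\<close> for \<open>r\<^sup>2 = x\<^sup>2 - 1\<close>.
\<close>

section \<open>Chebyshev polynomials of both kinds\<close>

text \<open>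
  This is \<open>U\<^bsub>n-1\<^esub>\<close>, the Chebyshev polynomial of the second kind, with the index shifted so that
  \<open>(T\<^sub>n, U\<^bsub>n-1\<^esub>)\<close> are the two components of the \<open>n\<close>-th power of \<open>x + sqrt (x\<^sup>2 - 1)\<close>, and with the
  first-order recursion that corresponds to multiplication by \<open>x + sqrt (x\<^sup>2 - 1)\<close>.
\<close>

fun shifted_chebyshev_U :: "nat \<Rightarrow> real poly" where
  "shifted_chebyshev_U 0 = 0"
| "shifted_chebyshev_U (Suc n) = [:0, 1:] * shifted_chebyshev_U n + chebyshev_T n"

lemma poly_chebyshev_T_Suc:
  fixes x :: real
  shows "poly (chebyshev_T (Suc n)) x
    = x * poly (chebyshev_T n) x + (x\<^sup>2 - 1) * poly (shifted_chebyshev_U n) x"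
proof (induction n)
  case (Suc n)
  define T U where "T = poly (chebyshev_T n) x" and "U = poly (shifted_chebyshev_U n) x"
  have IH: "poly (chebyshev_T (Suc n)) x = x * T + (x\<^sup>2 - 1) * U"
    using Suc.IH by (simp add: T_def U_def)
  have "poly (chebyshev_T (Suc (Suc n))) x = 2 * x * poly (chebyshev_T (Suc n)) x - T"
    by (simp add: T_def)
  also have "\<dots> = x * poly (chebyshev_T (Suc n)) x + (x\<^sup>2 - 1) * (x * U + T)"
    unfolding IH by (simp add: algebra_simps power2_eq_square)
  also have "x * U + T = poly (shifted_chebyshev_U (Suc n)) x"
    by (simp add: T_def U_def)
  finally show ?case .
qed simp

lemma chebyshev_T_Suc:
  "chebyshev_T (Suc n) = [:0, 1:] * chebyshev_T n + [:-1, 0, 1:] * shifted_chebyshev_U n"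
  by (rule iffD1[OF poly_eq_poly_eq_iff], rule ext)
    (simp add: poly_chebyshev_T_Suc power2_eq_square algebra_simps)

lemma degree_chebyshev_T_le: "degree (chebyshev_T n) \<le> n"
proof (induction n rule: chebyshev_T.induct)
  case (3 n)
  have "degree ([:0, 2:] * chebyshev_T (Suc n)) \<le> 1 + Suc n"
    using 3(1) by (intro order.trans[OF degree_mult_le]) simp
  then show ?case
    unfolding chebyshev_T.simps using 3(2) by (intro degree_diff_le) auto
qed auto

lemma degree_shifted_chebyshev_U_le: "degree (shifted_chebyshev_U n) \<le> n - 1"
proof (induction n)
  case (Suc n)
  show ?case
  proof (cases n)
    case (Suc m)
    have "degree ([:0, 1:] * shifted_chebyshev_U n) \<le> 1 + (n - 1)"
      using Suc.IH by (intro order.trans[OF degree_mult_le]) simp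
    then show ?thesis
      unfolding shifted_chebyshev_U.simps
      using degree_chebyshev_T_le[of n] Suc by (intro degree_add_le) auto
  qed simp
qed simp

text \<open>
  The recursions for \<open>T\<^sub>n\<close> and \<open>U\<^bsub>n-1\<^esub>\<close> are multiplication by \<open>x + r\<close>, with \<open>r\<^sup>2\<close> replaced by
  \<open>x\<^sup>2 - 1\<close>.  Both signs of \<open>r\<close> are allowed; adding and subtracting the two instances separates
  \<open>T\<^sub>n\<close> from \<open>U\<^bsub>n-1\<^esub>\<close>.
\<close>

lemma power_eq_chebyshev:
  fixes x r :: real
  assumes "r\<^sup>2 = x\<^sup>2 - 1"
  shows "(x + r) ^ n = poly (chebyshev_T n) x + r * poly (shifted_chebyshev_U n) x"
proof (induction n)
  case (Suc n)
  define T U where "T = poly (chebyshev_T n) x" and "U = poly (shifted_chebyshev_U n) x"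
  have "(x + r) ^ Suc n = (x + r) * (T + r * U)"
    using Suc.IH by (simp add: T_def U_def)
  also have "\<dots> = x * T + r\<^sup>2 * U + r * (x * U + T)"
    by (simp add: algebra_simps power2_eq_square)
  also have "\<dots> = poly (chebyshev_T (Suc n)) x + r * poly (shifted_chebyshev_U (Suc n)) x"
    unfolding assms by (simp add: poly_chebyshev_T_Suc T_def U_def algebra_simps)
  finally show ?case .
qed simp

lemma chebyshev_sums:
  fixes x r :: real
  assumes "r\<^sup>2 = x\<^sup>2 - 1"
  shows "(x + r) ^ n + (x - r) ^ n = 2 * poly (chebyshev_T n) x"
    and "(x + r) ^ n - (x - r) ^ n = 2 * r * poly (shifted_chebyshev_U n) x"
  using power_eq_chebyshev[OF assms, of n] power_eq_chebyshev[of "- r" x n] assms by simp_all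

lemma poly_chebyshev_cos:
  "poly (chebyshev_T n) (cos \<theta>) = cos (real n * \<theta>)"
  "sin \<theta> * poly (shifted_chebyshev_U n) (cos \<theta>) = sin (real n * \<theta>)"
proof (induction n)
  case (Suc n)
  have arg: "real (Suc n) * \<theta> = \<theta> + real n * \<theta>"
    by (simp add: algebra_simps)
  {
    case 1
    have "poly (chebyshev_T (Suc n)) (cos \<theta>)
        = cos \<theta> * poly (chebyshev_T n) (cos \<theta>)
          - sin \<theta> * (sin \<theta> * poly (shifted_chebyshev_U n) (cos \<theta>))"
      by (simp add: poly_chebyshev_T_Suc cos_squared_eq) (simp add: power2_eq_square)
    then show ?case
      by (simp only: Suc.IH arg cos_add)
  next
    case 2
    have "sin \<theta> * poly (shifted_chebyshev_U (Suc n)) (cos \<theta>)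
        = cos \<theta> * (sin \<theta> * poly (shifted_chebyshev_U n) (cos \<theta>))
          + sin \<theta> * poly (chebyshev_T n) (cos \<theta>)"
      by (simp add: algebra_simps)
    then show ?case
      by (simp only: Suc.IH arg sin_add add.commute)
  }
qed simp_all

lemma chebyshev_nonneg:
  fixes x :: real
  assumes "x \<ge> 1"
  shows "poly (chebyshev_T n) x \<ge> 0" "poly (shifted_chebyshev_U n) x \<ge> 0"
proof (induction n)
  case (Suc n)
  have "x * x \<ge> 1"
    using assms mult_mono[of 1 x 1 x] by simp
  {
    case 1
    have "poly (chebyshev_T (Suc n)) x
        = x * poly (chebyshev_T n) x + (x * x - 1) * poly (shifted_chebyshev_U n) x"
      by (simp add: poly_chebyshev_T_Suc power2_eq_square)
    then show ?case
      using Suc.IH assms \<open>x * x \<ge> 1\<close> by simp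
  next
    case 2
    show ?case
      using Suc.IH assms by simp
  }
qed simp_all

text \<open>
  Together these two rules amount to Chebyshev's differential equation for \<open>T\<^sub>n\<close>.  They share one
  induction because the step for each of them uses both.
\<close>

lemma poly_pderiv_chebyshev:
  fixes x :: real
  shows "poly (pderiv (chebyshev_T n)) x = real n * poly (shifted_chebyshev_U n) x"
    and "(1 - x\<^sup>2) * poly (pderiv (shifted_chebyshev_U n)) x
      = x * poly (shifted_chebyshev_U n) x - real n * poly (chebyshev_T n) x"
proof (induction n)
  case (Suc n)
  define T U T' U' where defs: "T = poly (chebyshev_T n) x" "U = poly (shifted_chebyshev_U n) x"
    "T' = poly (pderiv (chebyshev_T n)) x" "U' = poly (pderiv (shifted_chebyshev_U n)) x"
  have IH: "T' = real n * U" "(1 - x\<^sup>2) * U' = x * U - real n * T"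
    using Suc.IH by (simp_all add: defs)
  {
    case 1
    have "poly (pderiv (chebyshev_T (Suc n))) x = T + x * T' + 2 * x * U - (1 - x\<^sup>2) * U'"
      unfolding chebyshev_T_Suc pderiv_add pderiv_mult
      by (simp add: pderiv_pCons defs algebra_simps power2_eq_square)
    also have "\<dots> = real (Suc n) * (x * U + T)"
      unfolding IH by (simp add: algebra_simps)
    finally show ?case
      by (simp add: defs)
  next
    case 2
    have "(1 - x\<^sup>2) * poly (pderiv (shifted_chebyshev_U (Suc n))) x
        = (1 - x\<^sup>2) * U + x * ((1 - x\<^sup>2) * U') + (1 - x\<^sup>2) * T'"
      by (simp add: pderiv_add pderiv_mult pderiv_pCons defs algebra_simps)
    also have "\<dots> = x * (x * U + T) - real (Suc n) * (x * T + (x\<^sup>2 - 1) * U)"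
      unfolding IH by (simp add: algebra_simps power2_eq_square)
    finally show ?case
      by (simp add: poly_chebyshev_T_Suc defs)
  }
qed simp_all

lemma abs_poly_chebyshev_T_le_1:
  assumes "\<bar>y\<bar> \<le> 1"
  shows "\<bar>poly (chebyshev_T n) y\<bar> \<le> 1"
proof -
  have "poly (chebyshev_T n) y = cos (real n * arccos y)"
    using poly_chebyshev_cos(1)[of n "arccos y"] assms by (simp add: cos_arccos_abs)
  then show ?thesis
    by simp
qed

lemma abs_chebyshev_T_eq_1_cases:
  assumes "n \<ge> 1" "\<bar>y\<bar> \<le> 1" "\<bar>poly (chebyshev_T n) y\<bar> = 1"
  obtains k where "k \<le> n" "y = cos (real k * pi / real n)"
proof -
  define \<theta> where "\<theta> = arccos y"
  have \<theta>: "0 \<le> \<theta>" "\<theta> \<le> pi" "cos \<theta> = y"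
    using assms(2) arccos_lbound[of y] arccos_ubound[of y] by (auto simp: \<theta>_def cos_arccos_abs)
  have "\<bar>cos (real n * \<theta>)\<bar> = 1"
    using assms(3) poly_chebyshev_cos(1)[of n \<theta>] \<theta>(3) by simp
  then have "(cos (real n * \<theta>))\<^sup>2 = 1"
    by (simp add: abs_square_eq_1)
  then have "sin (real n * \<theta>) = 0"
    using sin_cos_squared_add[of "real n * \<theta>"] by simp
  then obtain i :: int where i: "real n * \<theta> = of_int i * pi"
    by (auto simp: sin_zero_iff_int2)
  have "0 \<le> of_int i * pi" "of_int i * pi \<le> real n * pi"
    using \<theta> by (simp_all flip: i add: mult_left_mono)
  then have "0 \<le> i" "i \<le> int n"
    using pi_gt_zero by (auto simp: zero_le_mult_iff)
  then have "nat i \<le> n" "y = cos (real (nat i) * pi / real n)"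
    using \<theta>(3) assms(1) by (simp_all flip: i)
  then show thesis
    by (rule that)
qed

section \<open>Nodes and the extrapolation weights\<close>

lemma admissible_nodes_less:
  assumes "admissible_nodes n a t" "i < j" "j \<le> n"
  shows "t i < t j"
  using assms(2,3)
proof (induction j)
  case (Suc j)
  have "t j < t (Suc j)"
    using assms(1) Suc.prems by (auto simp: admissible_nodes_def)
  then show ?case
    using Suc by (cases "i = j") auto
qed simp

lemma inj_on_admissible_nodes:
  assumes "admissible_nodes n a t"
  shows "inj_on t {..n}"
  using admissible_nodes_less[OF assms] by (intro linorder_inj_onI) (auto simp: less_imp_neq)

lemma admissible_nodes_bounds:
  assumes "admissible_nodes n a t" "j \<le> n"
  shows "0 \<le> t j" "t j \<le> a"
  using admissible_nodes_less[OF assms(1), of 0 j] admissible_nodes_less[OF assms(1), of j n] assms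
  by (cases "j = 0"; cases "j = n"; force simp: admissible_nodes_def)+

lemma vandermonde_system_extension_weights:
  assumes "inj_on t {..n}"
  shows "vandermonde_system n t (extension_weights n t)"
  using theI'[OF vandermonde_system_ex1[OF assms]] by (simp add: extension_weights_def)

lemma extension_weights_cong:
  assumes "\<And>i. i \<le> n \<Longrightarrow> s i = t i"
  shows "extension_weights n s = extension_weights n t"
  using assms by (simp add: extension_weights_def vandermonde_system_def)

text \<open>
  Testing the system on \<open>\<Prod>\<^sub>k (x - t\<^sub>k)\<close> over \<open>k \<noteq> j\<close> shows that \<open>w\<^sub>j\<close> can vanish only if \<open>-1\<close> is
  one of the other nodes.
\<close>

lemma vandermonde_weight_nonzero:
  assumes "vandermonde_system n t w" "j \<le> n" "\<And>k. k \<le> n \<Longrightarrow> t k \<noteq> -1"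
  shows "w j \<noteq> 0"
proof
  assume "w j = 0"
  define p where "p = (\<Prod>k\<in>{..n} - {j}. [:- t k, 1:])"
  have "degree p \<le> (\<Sum>k\<in>{..n} - {j}. 1)"
    unfolding p_def by (rule order.trans[OF degree_prod_sum_le]) auto
  also have "\<dots> = n"
    using assms(2) by simp
  finally have "poly p (-1) = (\<Sum>i\<le>n. w i * poly p (t i))"
    using vandermonde_system_poly[OF assms(1)] by simp
  also have "\<dots> = 0"
    using \<open>w j = 0\<close> by (intro sum.neutral) (auto simp: p_def poly_prod)
  finally obtain k where "k \<le> n" "- t k - 1 = 0"
    by (auto simp: p_def poly_prod)
  with assms(3)[of k] show False
    by simp
qed

section \<open>The Chebyshev lower bound\<close>

definition shifted_chebyshev_T :: "nat \<Rightarrow> real \<Rightarrow> real poly" where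
  "shifted_chebyshev_T n a = pcompose (chebyshev_T n) [:1, - 2 / a:]"

lemma poly_shifted_chebyshev_T:
  "poly (shifted_chebyshev_T n a) x = poly (chebyshev_T n) (1 - 2 * x / a)"
  by (simp add: shifted_chebyshev_T_def poly_pcompose mult.commute)

lemma chebyshev_T_eq_weighted_sum:
  assumes "vandermonde_system n t w"
  shows "poly (chebyshev_T n) (1 + 2 / a) = (\<Sum>j\<le>n. w j * poly (shifted_chebyshev_T n a) (t j))"
proof -
  have "degree (shifted_chebyshev_T n a) \<le> n * 1"
    unfolding shifted_chebyshev_T_def
    by (rule order.trans[OF degree_pcompose_le]) (intro mult_mono degree_chebyshev_T_le; simp)
  then show ?thesis
    using vandermonde_system_poly[OF assms, of "shifted_chebyshev_T n a"]
    by (simp add: poly_shifted_chebyshev_T)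
qed

lemma abs_affine_le_1:
  fixes a x :: real
  assumes "a > 0" "0 \<le> x" "x \<le> a"
  shows "\<bar>1 - 2 * x / a\<bar> \<le> 1"
  using assms by (simp add: abs_le_iff field_simps)

lemma weighted_term_le:
  assumes "a > 0" "0 \<le> x" "x \<le> a"
  shows "w * poly (shifted_chebyshev_T n a) x \<le> \<bar>w\<bar>"
proof -
  have "\<bar>w * poly (shifted_chebyshev_T n a) x\<bar> \<le> \<bar>w\<bar>"
    using abs_poly_chebyshev_T_le_1[OF abs_affine_le_1[OF assms], of n]
    by (simp add: abs_mult poly_shifted_chebyshev_T mult_left_le)
  then show ?thesis
    by simp
qed

lemma l1_norm_weights_ge:
  assumes "a > 0" "admissible_nodes n a t" "vandermonde_system n t w"
  shows "poly (chebyshev_T n) (1 + 2 / a) \<le> l1_norm n w"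
  unfolding chebyshev_T_eq_weighted_sum[OF assms(3)] l1_norm_def
  using admissible_nodes_bounds[OF assms(2)] assms(1) by (intro sum_mono weighted_term_le) auto

lemma chebyshev_nodes_less:
  assumes "a > 0" "i < j" "j \<le> n"
  shows "chebyshev_nodes n a i < chebyshev_nodes n a j"
proof -
  have "cos (real j * pi / real n) < cos (real i * pi / real n)"
    using assms by (intro cos_monotone_0_pi) (auto simp: field_simps)
  then show ?thesis
    using assms(1) by (simp add: chebyshev_nodes_def)
qed

lemma admissible_chebyshev_nodes:
  assumes "n \<ge> 1" "a > 0"
  shows "admissible_nodes n a (chebyshev_nodes n a)"
  using assms chebyshev_nodes_less[of a _ "Suc _" n]
  by (auto simp: admissible_nodes_def chebyshev_nodes_def)

lemma strictly_increasing_selfmap_atMost: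
  fixes f :: "nat \<Rightarrow> nat"
  assumes "\<And>i. i < n \<Longrightarrow> f i < f (Suc i)" "f n \<le> n" "i \<le> n"
  shows "f i = i"
proof (rule antisym)
  show "i \<le> f i"
    using \<open>i \<le> n\<close>
  proof (induction i)
    case (Suc i)
    then show ?case
      using assms(1)[of i] by simp
  qed simp
  show "f i \<le> i"
    using \<open>i \<le> n\<close>
  proof (induction i rule: inc_induct)
    case (step i)
    then show ?case
      using assms(1)[of i] by simp
  qed (fact assms(2))
qed

text \<open>
  Equality in the lower bound is equality in every summand \<open>w\<^sub>j q(t\<^sub>j) \<le> \<bar>w\<^sub>j\<bar>\<close>, where \<open>w\<^sub>j \<noteq> 0\<close>.  So
  all nodes are extremal points of \<open>q\<close>, and there are just enough of these for \<open>n + 1\<close> nodes.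
\<close>

lemma nodes_eq_if_l1_norm_le:
  assumes "n \<ge> 1" "a > 0" "admissible_nodes n a t" "vandermonde_system n t w"
    and le: "l1_norm n w \<le> poly (chebyshev_T n) (1 + 2 / a)"
    and "i \<le> n"
  shows "t i = chebyshev_nodes n a i"
proof -
  let ?q = "poly (shifted_chebyshev_T n a)"
  note bounds = admissible_nodes_bounds[OF assms(3)]
  have "(\<Sum>j\<le>n. w j * ?q (t j)) = (\<Sum>j\<le>n. \<bar>w j\<bar>)"
    using le l1_norm_weights_ge[OF assms(2-4)]
    unfolding chebyshev_T_eq_weighted_sum[OF assms(4)] l1_norm_def by simp
  then have eq: "w j * ?q (t j) = \<bar>w j\<bar>" if "j \<le> n" for j
    using that bounds assms(2)
    by (intro sum_mono_inv[where I = "{..n}" and f = "\<lambda>j. w j * ?q (t j)"] weighted_term_le) auto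
  have extremal: "\<exists>k\<le>n. t j = chebyshev_nodes n a k" if "j \<le> n" for j
  proof -
    have "w j \<noteq> 0"
      using bounds(1) by (intro vandermonde_weight_nonzero[OF assms(4) that]) force
    moreover have "\<bar>w j\<bar> * \<bar>?q (t j)\<bar> = \<bar>w j\<bar> * 1"
      using eq[OF that] by (simp flip: abs_mult)
    ultimately have "\<bar>poly (chebyshev_T n) (1 - 2 * t j / a)\<bar> = 1"
      by (simp add: poly_shifted_chebyshev_T)
    with abs_affine_le_1[OF assms(2) bounds[OF that]]
    obtain k where "k \<le> n" "1 - 2 * t j / a = cos (real k * pi / real n)"
      by (rule abs_chebyshev_T_eq_1_cases[OF assms(1)])
    then show ?thesis
      using assms(2) by (intro exI[of _ k]) (auto simp: chebyshev_nodes_def field_simps)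
  qed
  then obtain f where f: "f j \<le> n" "t j = chebyshev_nodes n a (f j)" if "j \<le> n" for j
    by metis
  have "f j < f (Suc j)" if "j < n" for j
  proof (rule ccontr)
    assume "\<not> f j < f (Suc j)"
    then have "t (Suc j) \<le> t j"
      using f[of j] f[of "Suc j"] that chebyshev_nodes_less[OF assms(2), of "f (Suc j)" "f j" n]
      by (cases "f (Suc j) = f j") auto
    then show False
      using assms(3) that by (auto simp: admissible_nodes_def)
  qed
  then have "f i = i"
    using f(1)[of n] assms(6) by (intro strictly_increasing_selfmap_atMost[of n f]) auto
  then show ?thesis
    using f(2)[OF assms(6)] by simp
qed

section \<open>The weights at the Chebyshev nodes\<close>

text \<open>
  Let \<open>N\<close> have degree at most \<open>n + 1\<close> and vanish at the transformed nodes \<open>y\<^sub>k = 1 - 2 t\<^sub>k / a\<close>.  Then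
  \<open>N / (y - y\<^sub>i)\<close> has degree at most \<open>n\<close>, vanishes at all nodes except \<open>y\<^sub>i\<close>, and takes the value \<open>N'(y\<^sub>i)\<close>
  there; so the system isolates the single weight \<open>w\<^sub>i\<close>.
\<close>

lemma vandermonde_weight_nodal_poly:
  fixes N :: "real poly"
  assumes "a > 0" "vandermonde_system n t w" "inj_on t {..n}" "i \<le> n"
    and deg: "degree N \<le> Suc n"
    and zero: "\<And>k. k \<le> n \<Longrightarrow> poly N (1 - 2 * t k / a) = 0"
  shows "w i * poly (pderiv N) (1 - 2 * t i / a) * (2 / a * (1 + t i)) = poly N (1 + 2 / a)"
proof -
  define y where "y k = 1 - 2 * t k / a" for k
  obtain R where R: "N = [:- y i, 1:] * R"
    using zero[OF assms(4)] by (auto simp: y_def poly_eq_0_iff_dvd elim: dvdE)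
  have R_zero: "poly R (y k) = 0" if "k \<le> n" "k \<noteq> i" for k
  proof -
    have "y k \<noteq> y i"
      using that assms(1,3,4) by (auto simp: y_def dest: inj_onD)
    then show ?thesis
      using zero[OF that(1)] by (simp add: R flip: y_def)
  qed
  have R_i: "poly R (y i) = poly (pderiv N) (y i)"
    by (simp add: R pderiv_mult pderiv_pCons del: mult_pCons_left)
  have "degree R \<le> n"
    using deg degree_mult_eq[of "[:- y i, 1:]" R] by (cases "R = 0") (auto simp: R)
  then have "degree (pcompose R [:1, - 2 / a:]) \<le> n * 1"
    by (intro order.trans[OF degree_pcompose_le] mult_mono) simp_all
  then have "poly R (1 + 2 / a) = (\<Sum>k\<le>n. w k * poly R (y k))"
    using vandermonde_system_poly[OF assms(2), of "pcompose R [:1, - 2 / a:]"]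
    by (simp add: poly_pcompose y_def mult.commute)
  also have "\<dots> = (\<Sum>k\<in>{i}. w k * poly R (y k))"
    using R_zero assms(4) by (intro sum.mono_neutral_right) auto
  finally have "poly R (1 + 2 / a) = w i * poly (pderiv N) (y i)"
    by (simp add: R_i)
  moreover have "poly N (1 + 2 / a) = (2 / a * (1 + t i)) * poly R (1 + 2 / a)"
    by (simp add: R y_def algebra_simps add_divide_distrib)
  ultimately show ?thesis
    by (simp add: y_def)
qed

lemma affine_chebyshev_nodes:
  assumes "a > 0"
  shows "1 - 2 * chebyshev_nodes n a i / a = cos (real i * pi / real n)"
  using assms by (simp add: chebyshev_nodes_def)

lemma poly_chebyshev_T_extremal:
  assumes "n \<ge> 1"
  shows "poly (chebyshev_T n) (cos (real i * pi / real n)) = (-1) ^ i"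
  using assms by (simp add: poly_chebyshev_cos)

definition nodal_poly :: "nat \<Rightarrow> real poly" where
  "nodal_poly n = [:1, 0, -1:] * shifted_chebyshev_U n"

lemma poly_nodal_poly: "poly (nodal_poly n) x = (1 - x\<^sup>2) * poly (shifted_chebyshev_U n) x"
  by (simp add: nodal_poly_def power2_eq_square algebra_simps)

lemma degree_nodal_poly_le:
  assumes "n \<ge> 1"
  shows "degree (nodal_poly n) \<le> Suc n"
proof -
  have "degree (nodal_poly n) \<le> 2 + (n - 1)"
    unfolding nodal_poly_def
    by (rule order.trans[OF degree_mult_le]) (intro add_mono degree_shifted_chebyshev_U_le; simp)
  then show ?thesis
    using assms by simp
qed

lemma nodal_poly_extremal:
  assumes "n \<ge> 1"
  shows "poly (nodal_poly n) (cos (real i * pi / real n)) = 0"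
proof -
  define \<theta> where "\<theta> = real i * pi / real n"
  have "poly (nodal_poly n) (cos \<theta>) = sin \<theta> * (sin \<theta> * poly (shifted_chebyshev_U n) (cos \<theta>))"
    by (simp add: poly_nodal_poly cos_squared_eq) (simp add: power2_eq_square)
  also have "\<dots> = sin \<theta> * sin (real i * pi)"
    using assms by (simp only: poly_chebyshev_cos) (simp add: \<theta>_def)
  finally show ?thesis
    by (simp add: \<theta>_def sin_npi)
qed

text \<open>
  By the differential equation the derivative of \<open>(1 - x\<^sup>2) U\<^bsub>n-1\<^esub>\<close> is \<open>- x U\<^bsub>n-1\<^esub> - n T\<^sub>n\<close>.  At an
  interior node \<open>U\<^bsub>n-1\<^esub>\<close> vanishes; at \<open>x = \<plusminus>1\<close> the differential equation degenerates to
  \<open>x U\<^bsub>n-1\<^esub> = n T\<^sub>n\<close>, which doubles the value.  This is the origin of the Kronecker deltas.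
\<close>

lemma pderiv_nodal_poly_extremal:
  assumes "n \<ge> 1" "i \<le> n"
  shows "poly (pderiv (nodal_poly n)) (cos (real i * pi / real n))
    = - ((1 + kronecker i 0 + kronecker i n) * real n * (-1) ^ i)"
proof -
  define x where "x = cos (real i * pi / real n)"
  define U where "U = poly (shifted_chebyshev_U n) x"
  have T: "poly (chebyshev_T n) x = (-1) ^ i"
    unfolding x_def using poly_chebyshev_T_extremal[OF assms(1)] .
  have ode: "(1 - x\<^sup>2) * poly (pderiv (shifted_chebyshev_U n)) x = x * U - real n * (-1) ^ i"
    using poly_pderiv_chebyshev(2)[of x n] by (simp add: T U_def)
  have "poly (pderiv (nodal_poly n)) x
      = (1 - x\<^sup>2) * poly (pderiv (shifted_chebyshev_U n)) x - 2 * x * U"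
    unfolding nodal_poly_def pderiv_mult
    by (simp add: pderiv_pCons U_def algebra_simps power2_eq_square)
  then have deriv: "poly (pderiv (nodal_poly n)) x = - x * U - real n * (-1) ^ i"
    by (simp add: ode)
  show ?thesis
  proof (cases "i = 0 \<or> i = n")
    case True
    then have "x\<^sup>2 = 1"
      using assms(1) by (auto simp: x_def)
    moreover have "kronecker i 0 + kronecker i n = 1"
      using True assms(1) by (auto simp: kronecker_def)
    ultimately show ?thesis
      using ode deriv by (simp add: x_def add.assoc)
  next
    case False
    have "0 < sin (real i * pi / real n)"
      using False assms by (intro sin_gt_zero) (auto simp: field_simps)
    then have "1 - x\<^sup>2 \<noteq> 0"
      by (simp add: x_def flip: sin_squared_eq)
    then have "U = 0"
      using nodal_poly_extremal[OF assms(1), of i] by (simp add: poly_nodal_poly U_def flip: x_def)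
    then show ?thesis
      using False deriv by (simp add: x_def kronecker_def)
  qed
qed

lemma C_const_eq:
  assumes "a > 0"
  shows "C_const n a = 2 * (1 + a) * poly (shifted_chebyshev_U n) (1 + 2 / a)"
proof -
  define x r where "x = 1 + 2 / a" and "r = sqrt (x\<^sup>2 - 1)"
  have "x > 1"
    using assms by (simp add: x_def)
  then have "x\<^sup>2 > 1"
    by (simp add: one_less_power)
  then have "r > 0" "r\<^sup>2 = x\<^sup>2 - 1"
    by (simp_all add: r_def)
  then show ?thesis
    using chebyshev_sums(2)[of r x n]
    by (simp add: C_const_def Let_def flip: x_def r_def)
qed

lemma chebyshev_weight_eq:
  assumes "n \<ge> 1" "a > 0" "i \<le> n"
  shows "extension_weights n (chebyshev_nodes n a) i =
    (-1) ^ i * (C_const n a /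
      ((1 + kronecker i 0 + kronecker i n) * real n * a * (1 + chebyshev_nodes n a i)))"
proof -
  define t where "t = chebyshev_nodes n a"
  define w where "w = extension_weights n t i"
  define d where "d = (1 + kronecker i 0 + kronecker i n) * real n"
  define U where "U = poly (shifted_chebyshev_U n) (1 + 2 / a)"
  have adm: "admissible_nodes n a t"
    unfolding t_def by (rule admissible_chebyshev_nodes[OF assms(1,2)])
  have "t i \<ge> 0" "d > 0"
    using admissible_nodes_bounds(1)[OF adm assms(3)] assms(1)
    by (auto simp: d_def kronecker_def)
  have "vandermonde_system n t (extension_weights n t)"
    by (intro vandermonde_system_extension_weights inj_on_admissible_nodes[OF adm])
  then have "w * poly (pderiv (nodal_poly n)) (1 - 2 * t i / a) * (2 / a * (1 + t i))
      = poly (nodal_poly n) (1 + 2 / a)"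
    unfolding w_def using assms inj_on_admissible_nodes[OF adm] degree_nodal_poly_le[OF assms(1)]
    by (intro vandermonde_weight_nodal_poly)
      (simp_all add: t_def affine_chebyshev_nodes nodal_poly_extremal)
  then have "w * (- (d * (-1) ^ i)) * (2 / a * (1 + t i)) = (1 - (1 + 2 / a)\<^sup>2) * U"
    using assms
    by (simp add: t_def affine_chebyshev_nodes pderiv_nodal_poly_extremal poly_nodal_poly d_def U_def)
  then have "w * (d * (-1) ^ i) * (2 / a * (1 + t i)) = ((1 + 2 / a)\<^sup>2 - 1) * U"
    by (simp only: left_diff_distrib mult_minus_right mult_minus_left)
  \<comment> \<open>Since \<open>x\<^sub>0\<^sup>2 - 1 = 4 (1 + a) / a\<^sup>2\<close>, the factor \<open>a\<^sup>2 / 2\<close> turns the right-hand side into \<open>C\<^sub>n(a)\<close>.\<close>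
  then have "(a\<^sup>2 / 2) * (w * (d * (-1) ^ i) * (2 / a * (1 + t i)))
      = (a\<^sup>2 / 2) * (((1 + 2 / a)\<^sup>2 - 1) * U)"
    by (rule arg_cong)
  moreover have "(a\<^sup>2 / 2) * (w * (d * (-1) ^ i) * (2 / a * (1 + t i)))
      = (-1) ^ i * w * (d * a * (1 + t i))"
    using assms(2) by (simp add: power2_eq_square)
  moreover have "(a\<^sup>2 / 2) * (((1 + 2 / a)\<^sup>2 - 1) * U) = 2 * (1 + a) * U"
    using assms(2) by (simp add: field_simps power2_eq_square)
  ultimately have "(-1) ^ i * w * (d * a * (1 + t i)) = 2 * (1 + a) * U"
    by metis
  then have "(-1) ^ i * w * (d * a * (1 + t i)) = C_const n a"
    using assms(2) by (simp add: C_const_eq U_def)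
  then have "(-1) ^ i * w = C_const n a / (d * a * (1 + t i))"
    using \<open>t i \<ge> 0\<close> \<open>d > 0\<close> assms(2) by (subst nonzero_eq_divide_eq) auto
  then have "(-1) ^ i * ((-1) ^ i * w) = (-1) ^ i * (C_const n a / (d * a * (1 + t i)))"
    by simp
  moreover have "(-1) ^ i * ((-1) ^ i * w) = w"
    by (simp flip: mult.assoc power_mult_distrib)
  ultimately show ?thesis
    by (simp add: w_def t_def d_def)
qed

text \<open>
  The weights alternate in sign exactly as the values \<open>q(t\<^sub>i\<^sup>*) = (-1)\<^sup>i\<close> do, so every summand
  \<open>w\<^sub>i\<^sup>* q(t\<^sub>i\<^sup>*)\<close> is \<open>\<bar>w\<^sub>i\<^sup>*\<bar>\<close> and the lower bound is attained.
\<close>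

lemma l1_norm_chebyshev_weights:
  assumes "n \<ge> 1" "a > 0"
  shows "l1_norm n (extension_weights n (chebyshev_nodes n a)) = poly (chebyshev_T n) (1 + 2 / a)"
proof -
  define t where "t = chebyshev_nodes n a"
  define w where "w = extension_weights n t"
  have adm: "admissible_nodes n a t"
    unfolding t_def by (rule admissible_chebyshev_nodes[OF assms])
  have abs_w: "\<bar>w i\<bar> = w i * poly (shifted_chebyshev_T n a) (t i)" if "i \<le> n" for i
  proof -
    define c where "c = C_const n a / ((1 + kronecker i 0 + kronecker i n) * real n * a * (1 + t i))"
    have "c \<ge> 0"
      using assms chebyshev_nonneg(2)[of "1 + 2 / a" n] admissible_nodes_bounds(1)[OF adm that]
      by (auto simp: c_def C_const_eq kronecker_def intro!: divide_nonneg_nonneg mult_nonneg_nonneg)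
    moreover have "w i = (-1) ^ i * c"
      using chebyshev_weight_eq[OF assms that] by (simp add: w_def t_def c_def)
    moreover have "poly (shifted_chebyshev_T n a) (t i) = (-1) ^ i"
      using assms
      by (simp add: poly_shifted_chebyshev_T t_def affine_chebyshev_nodes poly_chebyshev_T_extremal)
    ultimately show ?thesis
      by (simp add: abs_mult mult.assoc mult.left_commute flip: power_mult_distrib)
  qed
  have "vandermonde_system n t w"
    unfolding w_def
    by (intro vandermonde_system_extension_weights inj_on_admissible_nodes[OF adm])
  then show ?thesis
    using abs_w
    by (simp add: chebyshev_T_eq_weighted_sum[of n t w a] l1_norm_def flip: t_def w_def)
qed

section \<open>Optimality\<close>

lemma optimal_nodes_iff_chebyshev:
  assumes "n \<ge> 1" "a > 0"
  shows "optimal_nodes n a t \<longleftrightarrow> (\<forall>i\<le>n. t i = chebyshev_nodes n a i)"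
proof
  note norm_eq = l1_norm_chebyshev_weights[OF assms]
  note system = vandermonde_system_extension_weights[OF inj_on_admissible_nodes]
  {
    assume "optimal_nodes n a t"
    then have adm: "admissible_nodes n a t"
      and "l1_norm n (extension_weights n t)
        \<le> l1_norm n (extension_weights n (chebyshev_nodes n a))"
      using admissible_chebyshev_nodes[OF assms]
      by (auto simp: optimal_nodes_def is_arg_min_def not_less)
    then show "\<forall>i\<le>n. t i = chebyshev_nodes n a i"
      using nodes_eq_if_l1_norm_le[OF assms adm system[OF adm]] norm_eq by simp
  next
    assume eq: "\<forall>i\<le>n. t i = chebyshev_nodes n a i"
    then have "l1_norm n (extension_weights n t) = poly (chebyshev_T n) (1 + 2 / a)"
      using norm_eq extension_weights_cong[of n t "chebyshev_nodes n a"] by simp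
    moreover have "admissible_nodes n a t"
      using admissible_chebyshev_nodes[OF assms] eq by (simp add: admissible_nodes_def)
    ultimately show "optimal_nodes n a t"
      using l1_norm_weights_ge[OF assms(2) _ system]
      by (auto simp: optimal_nodes_def is_arg_min_def not_less)
  }
qed

lemma chebyshev_T_closed_form:
  assumes "a > 0"
  shows "poly (chebyshev_T n) (1 + 2 / a) =
    1 / 2 * ((1 + 2 / a - 2 * sqrt (1 / a + 1 / a\<^sup>2)) ^ n
           + (1 + 2 / a + 2 * sqrt (1 / a + 1 / a\<^sup>2)) ^ n)"
proof -
  have "(2 * sqrt (1 / a + 1 / a\<^sup>2))\<^sup>2 = 4 * (1 / a + 1 / a\<^sup>2)"
    using assms by (simp add: power_mult_distrib)
  also have "\<dots> = (1 + 2 / a)\<^sup>2 - 1"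
    using assms by (simp add: field_simps power2_eq_square)
  finally show ?thesis
    using chebyshev_sums(1)[of "2 * sqrt (1 / a + 1 / a\<^sup>2)" "1 + 2 / a" n] by simp
qed

theorem theorem2p13:
  fixes n :: nat and a :: real
  assumes "n \<ge> 1" and "a > 0"
  shows "(\<forall>t. optimal_nodes n a t \<longleftrightarrow> (\<forall>i\<le>n. t i = chebyshev_nodes n a i))
    \<and> (\<forall>i\<le>n. extension_weights n (chebyshev_nodes n a) i =
          (-1) ^ i * (C_const n a /
            ((1 + kronecker i 0 + kronecker i n) * real n * a * (1 + chebyshev_nodes n a i))))
    \<and> l1_norm n (extension_weights n (chebyshev_nodes n a)) = poly (chebyshev_T n) (1 + 2 / a)
    \<and> poly (chebyshev_T n) (1 + 2 / a) =
          1 / 2 * ((1 + 2 / a - 2 * sqrt (1 / a + 1 / a\<^sup>2)) ^ n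
                 + (1 + 2 / a + 2 * sqrt (1 / a + 1 / a\<^sup>2)) ^ n)"
  using optimal_nodes_iff_chebyshev[OF assms] chebyshev_weight_eq[OF assms]
    l1_norm_chebyshev_weights[OF assms] chebyshev_T_closed_form[OF assms(2), of n]
  by blast

end
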